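(* Let $D\ge 2$ be an integer. Define $$\sigma_D=\frac{1}{2^D}\sum_{s=0}^D\binom{D}{s}\max\{s,D-s\}$$ and $$\hat I_D^*=\begin{cases}\dfrac{\sum_{w=1}^{(D-1)/2}\binom{D}{w}w}{\sum_{w=1}^{(D-1)/2}\binom{D}{w}} & \text{if } D \text{ is odd},\\[3ex] \dfrac{\sum_{w=1}^{D/2-1}\binom{D}{w}w+\frac12\binom{D}{D/2}\frac{D}{2}}{\sum_{w=1}^{D/2-1}\binom{D}{w}+\frac12\binom{D}{D/2}} & \text{if } D \text{ is even}.\end{cases}$$ Then $$\sigma_D=D+(2^{1-D}-1)\,\hat I_D^*.$$ Consequently, for every value $e_{\max}\in[0,1]$, the satisfaction fractions $$\frac{s_{\mathrm{TP}}}{m}=e_{\max}+\frac{\sigma_D}{D}(1-e_{\max})\qquad\text{and}\qquad \frac{\langle s\rangle}{m}=1-(1-e_{\max})(1-2^{1-D})\frac{\hat I_D^*}{D}$$ (of the Turbo Prange algorithm and of the Regev+FGUM quantum algorithm, respectively) are equal: $$\frac{s_{\mathrm{TP}}}{m}=\frac{\langle s\rangle}{m}.$$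
   Context: All quantities are defined explicitly in the claim. Empty sums are $0$. For interpretation: $\hat I_D^*$ is the average Hamming weight of a uniformly random nonzero element of a set $I_D\subset\mathbb{F}_2^D$ of size $2^{D-1}$ consisting of all words of weight less than $D/2$ together with (for even $D$) one word of each complementary pair of words of weight $D/2$; $e_{\max}$ is the same block-erasure threshold in both formulas, and the equality does not depend on its value. *)

theory Defs
  imports Complex_Main
begin

definition sigma_D :: "nat \<Rightarrow> real" where
  "sigma_D D = (1 / 2 ^ D) * (\<Sum>s = 0..D. real (D choose s) * max (real s) (real D - real s))"

(* The divisions by 2 inside the summation bounds and inside the binomial coefficient are
   divisions of natural numbers; they are exact in the branch where they occur. *)
definition I_hat :: "nat \<Rightarrow> real" where
  "I_hat D =
    (if odd D then
       (\<Sum>w = 1..(D - 1) div 2. real (D choose w) * real w) /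
       (\<Sum>w = 1..(D - 1) div 2. real (D choose w))
     else
       ((\<Sum>w = 1..D div 2 - 1. real (D choose w) * real w)
          + 1 / 2 * real (D choose (D div 2)) * (real D / 2)) /
       ((\<Sum>w = 1..D div 2 - 1. real (D choose w))
          + 1 / 2 * real (D choose (D div 2))))"

(* Satisfaction fraction s_TP / m of the Turbo Prange algorithm at erasure threshold e_max. *)
definition turbo_prange_fraction :: "nat \<Rightarrow> real \<Rightarrow> real" where
  "turbo_prange_fraction D e_max = e_max + sigma_D D / real D * (1 - e_max)"

(* Expected satisfaction fraction <s> / m of the Regev+FGUM quantum algorithm
   at erasure threshold e_max. *)
definition regev_fgum_fraction :: "nat \<Rightarrow> real \<Rightarrow> real" where
  "regev_fgum_fraction D e_max =
     1 - (1 - e_max) * (1 - 2 powi (1 - int D)) * (I_hat D / real D)"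

end

(* Since max s (D - s) = D - min s (D - s), sigma_D is D minus 2^(-D) times the sum of
   (D choose s) * min s (D - s). The reflection s -> D - s folds this sum to twice the numerator
   of I_hat D, and folds the sum 2^D of all binomial coefficients to twice the denominator
   plus 2, so the denominator is 2^(D-1) - 1. *)
theory Submission
  imports Defs
begin

text \<open>The reflection \<open>s\<close> -> \<open>D - s\<close> carries the first
  \<open>k\<close> indices onto the last \<open>k\<close> and maps the middle block to itself. The
  bound on \<open>k\<close> keeps the two ends disjoint; at \<open>2 * k = D + 1\<close> the middle
  block is empty.\<close>

lemma sum_reflect_fold:
  fixes f :: "nat \<Rightarrow> 'a::comm_semiring_1"
  assumes sym: "\<And>s. s \<le> D \<Longrightarrow> f (D - s) = f s" and k: "2 * k \<le> D + 1"
  shows "(\<Sum>s=0..D. f s) = 2 * (\<Sum>s<k. f s) + (\<Sum>s=k..D-k. f s)"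
proof -
  have split: "{0..D} = {..<k} \<union> {k..D-k} \<union> {s. D - k < s \<and> s \<le> D}"
    using k by auto
  have fin: "finite {s. D - k < s \<and> s \<le> D}"
    by (rule finite_subset[of _ "{..D}"]) auto
  have "(\<Sum>s | D - k < s \<and> s \<le> D. f s) = (\<Sum>s<k. f s)"
    by (rule sum.reindex_bij_witness[of _ "\<lambda>s. D - s" "\<lambda>s. D - s"]) (use k sym in auto)
  moreover have "(\<Sum>s=0..D. f s) =
      (\<Sum>s<k. f s) + (\<Sum>s=k..D-k. f s) + (\<Sum>s | D - k < s \<and> s \<le> D. f s)"
    unfolding split using k fin by (subst sum.union_disjoint; auto)+
  ultimately show ?thesis by (simp add: mult_2 ac_simps)
qed

text \<open>Common shape of numerator and denominator of \<open>I_hat\<close>. For even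
  \<open>D\<close> the index \<open>D div 2\<close> is fixed by the reflection, hence its weight
  1/2. Index 0, the zero word, is left out.\<close>

definition half_sum :: "nat \<Rightarrow> (nat \<Rightarrow> real) \<Rightarrow> real" where
  "half_sum D f =
    (if odd D then \<Sum>w = 1..(D - 1) div 2. f w
     else (\<Sum>w = 1..D div 2 - 1. f w) + f (D div 2) / 2)"

lemma sum_eq_half_sum:
  fixes f :: "nat \<Rightarrow> real"
  assumes sym: "\<And>s. s \<le> D \<Longrightarrow> f (D - s) = f s" and D: "D \<ge> 1"
  shows "(\<Sum>s=0..D. f s) = 2 * (f 0 + half_sum D f)"
proof (cases "odd D")
  case True
  then obtain m where m: "D = 2 * m + 1" by (auto elim: oddE)
  have "(\<Sum>s<Suc m. f s) = f 0 + (\<Sum>s=1..m. f s)"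
    by (simp add: lessThan_Suc_atMost atMost_atLeast0 sum.atLeast_Suc_atMost)
  \<comment> \<open>Here the middle block runs from \<open>m + 1\<close> to \<open>m\<close>, so it
    is empty.\<close>
  with sum_reflect_fold[of D f "Suc m", OF sym] show ?thesis
    by (simp add: half_sum_def m)
next
  case False
  then obtain m where m: "D = 2 * m" by (auto elim: evenE)
  \<comment> \<open>Positivity of \<open>m\<close> keeps index 0 apart from the fixed point
    \<open>m\<close>, which is the whole middle block below.\<close>
  with D obtain n where n: "m = Suc n" by (cases m) auto
  have "(\<Sum>s<m. f s) = f 0 + (\<Sum>s=1..m-1. f s)"
    by (simp add: n lessThan_Suc_atMost atMost_atLeast0 sum.atLeast_Suc_atMost)
  with sum_reflect_fold[of D f m, OF sym] show ?thesis
    by (simp add: half_sum_def m)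
qed

text \<open>Up to \<open>D / 2\<close> the weight \<open>w\<close> is \<open>min w (D - w)\<close>;
  the latter form is invariant under reflection, so the numerator can be folded too.\<close>

lemma I_hat_eq_half_sum:
  "I_hat D = half_sum D (\<lambda>s. real (D choose s) * min (real s) (real D - real s)) /
             half_sum D (\<lambda>s. real (D choose s))"
proof (cases "odd D")
  case True
  then obtain m where m: "D = 2 * m + 1" by (auto elim: oddE)
  have "(\<Sum>w=1..m. real (D choose w) * real w) =
        (\<Sum>w=1..m. real (D choose w) * min (real w) (real D - real w))"
    by (rule sum.cong) (auto simp: m min_def)
  then show ?thesis by (simp add: I_hat_def half_sum_def m)
next
  case False
  then obtain m where m: "D = 2 * m" by (auto elim: evenE)
  have "(\<Sum>w=1..m-1. real (D choose w) * real w) =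
        (\<Sum>w=1..m-1. real (D choose w) * min (real w) (real D - real w))"
    by (rule sum.cong) (auto simp: m min_def)
  then show ?thesis by (simp add: I_hat_def half_sum_def m)
qed

lemma sum_binomial_real: "(\<Sum>s=0..D. real (D choose s)) = 2 ^ D"
  using choose_row_sum[of D] by (simp add: atMost_atLeast0 flip: of_nat_sum)

text \<open>Folding the row sum \<open>2 ^ D\<close>; the subtracted 1 is
  \<open>D choose 0\<close>.\<close>

lemma half_sum_binomial:
  assumes "D \<ge> 1"
  shows "half_sum D (\<lambda>s. real (D choose s)) = 2 ^ D / 2 - 1"
proof -
  define h where "h = half_sum D (\<lambda>s. real (D choose s))"
  have "(\<Sum>s=0..D. real (D choose s)) = 2 * (1 + h)"
    unfolding h_def using sum_eq_half_sum[of D "\<lambda>s. real (D choose s)"] assms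
    by (simp add: binomial_symmetric[symmetric])
  then have "h = 2 ^ D / 2 - 1" by (simp add: sum_binomial_real field_simps)
  then show ?thesis by (simp only: h_def)
qed

lemma sigma_D_eq_half_sum:
  assumes "D \<ge> 1"
  shows "sigma_D D =
    real D - 2 * half_sum D (\<lambda>s. real (D choose s) * min (real s) (real D - real s)) / 2 ^ D"
proof -
  let ?g = "\<lambda>s. real (D choose s) * min (real s) (real D - real s)"
  have "?g (D - s) = ?g s" if "s \<le> D" for s
    using that by (simp add: binomial_symmetric[symmetric] of_nat_diff min.commute)
  \<comment> \<open>The term at index 0 vanishes because the minimum is 0 there.\<close>
  then have fold: "(\<Sum>s=0..D. ?g s) = 2 * half_sum D ?g"
    using sum_eq_half_sum[of D ?g] assms by simp
  have "(\<Sum>s=0..D. real (D choose s) * max (real s) (real D - real s)) =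
        (\<Sum>s=0..D. real D * real (D choose s) - ?g s)"
    by (rule sum.cong) (auto simp: max_def min_def algebra_simps)
  also have "\<dots> = real D * 2 ^ D - 2 * half_sum D ?g"
    by (simp add: sum_subtractf fold sum_binomial_real flip: sum_distrib_left)
  finally show ?thesis by (simp add: sigma_D_def field_simps)
qed

lemma sigma_D_eq_I_hat:
  assumes "D \<ge> 2"
  shows "sigma_D D = real D + (2 powi (1 - int D) - 1) * I_hat D"
proof -
  define N where "N = half_sum D (\<lambda>s. real (D choose s) * min (real s) (real D - real s))"
  define P :: real where "P = 2 ^ D"
  \<comment> \<open>This makes the denominator \<open>P / 2 - 1\<close> of \<open>I_hat\<close>
    nonzero.\<close>
  have "(2::real) ^ 2 \<le> 2 ^ D" using assms by (intro power_increasing) auto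
  then have P: "P \<ge> 4" by (simp add: P_def)
  have powi: "(2::real) powi (1 - int D) = 2 / P"
    by (simp add: power_int_diff P_def)
  have "I_hat D = N / (P / 2 - 1)"
    using I_hat_eq_half_sum half_sum_binomial assms by (simp add: N_def P_def)
  moreover have "sigma_D D = real D - 2 * N / P"
    using sigma_D_eq_half_sum assms by (simp add: N_def P_def)
  moreover have "(2 / P - 1) * (N / (P / 2 - 1)) = - (2 * N / P)"
  proof -
    define K where "K = P / 2 - 1"
    \<comment> \<open>The factor in front of \<open>I_hat\<close> is a multiple of its denominator
      \<open>K\<close>, which therefore cancels.\<close>
    have "2 / P - 1 = - (2 * K / P)" and "K \<noteq> 0"
      using P by (simp_all add: K_def field_simps)
    then show ?thesis by (simp flip: K_def)
  qed
  ultimately show ?thesis by (simp add: powi)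
qed

theorem mainTheorem3:
  fixes D :: nat
  assumes "D \<ge> 2"
  shows "sigma_D D = real D + (2 powi (1 - int D) - 1) * I_hat D \<and>
    (\<forall>e_max :: real. 0 \<le> e_max \<and> e_max \<le> 1 \<longrightarrow>
       turbo_prange_fraction D e_max = regev_fgum_fraction D e_max)"
proof -
  define q :: real where "q = 2 powi (1 - int D)"
  have sigma: "sigma_D D = real D + (q - 1) * I_hat D"
    using sigma_D_eq_I_hat[OF assms] by (simp add: q_def)
  \<comment> \<open>After substituting \<open>sigma\<close>, both sides equal
    \<open>1 - (1 - e) * (1 - q) * I_hat D / D\<close>.\<close>
  have "turbo_prange_fraction D e = regev_fgum_fraction D e" for e
    unfolding turbo_prange_fraction_def regev_fgum_fraction_def sigma q_def[symmetric]
    using assms by (simp add: field_simps)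
  with sigma show ?thesis by (simp add: q_def)
qed

end
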